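(* Let $U,V$ be subsets of $S^3$ and let $\partial U,\partial V$ be their boundaries in the topology of $S^3$. Then the boundary $\partial(U\otimes V)$ of $U\otimes V$ in the topology of $S^3$ is included in $\partial U\otimes\partial V$.
   Context: $S^3$ is the set of unit quaternions in the real quaternions $\mathbb{H}\cong\mathbb{R}^4$, with the topology induced by $\mathbb{R}^4$. For subsets $A,B\subseteq\mathbb{H}$, the Minkowski product is $A\otimes B=\{ab:a\in A,\ b\in B\}$ (quaternion product). *)

theory Defs
  imports "HOL-Analysis.Analysis"
begin

(* The quaternion a + b i + c j + d k is the vector (a, b, c, d); its modulus is the
   Euclidean norm. *)
type_synonym quat = "real^4"

definition qmult :: "quat \<Rightarrow> quat \<Rightarrow> quat"  (infixl \<open>\<cdot>\<^sub>q\<close> 70)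
  where "x \<cdot>\<^sub>q y =
    vector [x$1 * y$1 - x$2 * y$2 - x$3 * y$3 - x$4 * y$4,
            x$1 * y$2 + x$2 * y$1 + x$3 * y$4 - x$4 * y$3,
            x$1 * y$3 - x$2 * y$4 + x$3 * y$1 + x$4 * y$2,
            x$1 * y$4 + x$2 * y$3 - x$3 * y$2 + x$4 * y$1]"

definition minkowski_prod :: "quat set \<Rightarrow> quat set \<Rightarrow> quat set"  (infixl \<open>\<otimes>\<^sub>q\<close> 70)
  where "A \<otimes>\<^sub>q B = {a \<cdot>\<^sub>q b | a b. a \<in> A \<and> b \<in> B}"

definition S3 :: "quat set"
  where "S3 = sphere 0 1"

definition S3_top :: "quat topology"
  where "S3_top = top_of_set S3"

lemma qmult_nth:
  "(x \<cdot>\<^sub>q y)$1 = x$1 * y$1 - x$2 * y$2 - x$3 * y$3 - x$4 * y$4"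
  "(x \<cdot>\<^sub>q y)$2 = x$1 * y$2 + x$2 * y$1 + x$3 * y$4 - x$4 * y$3"
  "(x \<cdot>\<^sub>q y)$3 = x$1 * y$3 - x$2 * y$4 + x$3 * y$1 + x$4 * y$2"
  "(x \<cdot>\<^sub>q y)$4 = x$1 * y$4 + x$2 * y$3 - x$3 * y$2 + x$4 * y$1"
  by (simp_all add: qmult_def vector_def)

lemma hamilton_relations:
  defines "i \<equiv> axis 2 1" and "j \<equiv> axis 3 1" and "k \<equiv> axis 4 1"
  shows "i \<cdot>\<^sub>q i = - axis 1 1" "j \<cdot>\<^sub>q j = - axis 1 1" "k \<cdot>\<^sub>q k = - axis 1 1"
    "(i \<cdot>\<^sub>q j) \<cdot>\<^sub>q k = - axis 1 1"
  by (simp_all add: i_def j_def k_def vec_eq_iff forall_4 qmult_nth axis_def)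

lemma qmult_one: "axis 1 1 \<cdot>\<^sub>q x = x" "x \<cdot>\<^sub>q axis 1 1 = x"
  by (simp_all add: vec_eq_iff forall_4 qmult_nth axis_def)

lemma qmult_assoc: "(x \<cdot>\<^sub>q y) \<cdot>\<^sub>q z = x \<cdot>\<^sub>q (y \<cdot>\<^sub>q z)"
  by (simp add: vec_eq_iff forall_4 qmult_nth algebra_simps)

lemma norm_qmult: "norm (x \<cdot>\<^sub>q y) = norm x * norm y"
  by (simp add: norm_eq_sqrt_inner inner_vec_def sum_4 qmult_nth real_sqrt_mult [symmetric])
    algebra

end

theory Submission
  imports Defs
begin

text \<open>
  The argument works in any compact topological group. By compactness, the closure of
  \<open>U \<otimes>\<^sub>q V\<close> lies in the product of the closures of \<open>U\<close> and \<open>V\<close>, so a boundary point \<open>z\<close> of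
  \<open>U \<otimes>\<^sub>q V\<close> factors as \<open>z = u \<cdot>\<^sub>q v\<close> with \<open>u\<close> adherent to \<open>U\<close> and \<open>v\<close> adherent to \<open>V\<close>
  (\<open>closure_of_minkowski_prod_subset\<close>). Neither factor can be an interior point. Suppose
  that \<open>u\<close> is interior to \<open>U\<close>. A small change of \<open>v\<close> to some \<open>w\<close> in \<open>V\<close> can be compensated by
  replacing \<open>u\<close> with the quotient of \<open>z\<close> by \<open>w\<close>, which is still interior to \<open>U\<close>, and so \<open>z\<close>
  lies in the right translate by \<open>w\<close> of the interior of \<open>U\<close>. This translate is an open
  subset of \<open>U \<otimes>\<^sub>q V\<close>, which makes \<open>z\<close> an interior point
  (\<open>qmult_interior_closure\<close>). The case of \<open>v\<close> is the mirror image
  (\<open>qmult_closure_interior\<close>).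
\<close>

text \<open>Quaternion conjugation, which on \<open>S3\<close> is inversion.\<close>

definition qconj :: "quat \<Rightarrow> quat"
  where "qconj x = vector [x$1, - x$2, - x$3, - x$4]"

lemma qconj_nth:
  "qconj x $ 1 = x$1" "qconj x $ 2 = - x$2" "qconj x $ 3 = - x$3" "qconj x $ 4 = - x$4"
  by (simp_all add: qconj_def vector_def)

lemma qmult_in_S3: "x \<in> S3 \<Longrightarrow> y \<in> S3 \<Longrightarrow> x \<cdot>\<^sub>q y \<in> S3"
  by (simp add: S3_def norm_qmult)

lemma qconj_in_S3: "x \<in> S3 \<Longrightarrow> qconj x \<in> S3"
  by (simp add: S3_def norm_eq_sqrt_inner inner_vec_def sum_4 qconj_nth)

lemma S3_sum_squares: "x \<in> S3 \<Longrightarrow> x$1 * x$1 + x$2 * x$2 + x$3 * x$3 + x$4 * x$4 = 1"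
  by (simp add: S3_def norm_eq_sqrt_inner inner_vec_def sum_4)

lemma qmult_qconj:
  assumes "x \<in> S3"
  shows "x \<cdot>\<^sub>q qconj x = axis 1 1" and "qconj x \<cdot>\<^sub>q x = axis 1 1"
  using S3_sum_squares[OF assms]
  by (simp_all add: vec_eq_iff forall_4 qmult_nth qconj_nth axis_def algebra_simps)

lemma qmult_qconj_cancel:
  assumes "x \<in> S3"
  shows "(y \<cdot>\<^sub>q x) \<cdot>\<^sub>q qconj x = y" and "(y \<cdot>\<^sub>q qconj x) \<cdot>\<^sub>q x = y"
    and "qconj x \<cdot>\<^sub>q (x \<cdot>\<^sub>q y) = y" and "x \<cdot>\<^sub>q (qconj x \<cdot>\<^sub>q y) = y"
  using qmult_qconj[OF assms] by (metis qmult_assoc qmult_one)+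

lemma continuous_on_qmult [continuous_intros]:
  assumes "continuous_on S f" and "continuous_on S g"
  shows "continuous_on S (\<lambda>x. f x \<cdot>\<^sub>q g x)"
proof -
  have "continuous_on S (\<lambda>x. (f x \<cdot>\<^sub>q g x) $ i)" for i
    using exhaust_4[of i]
    by (elim disjE) (simp_all add: qmult_nth, (intro continuous_intros assms)+)
  then show ?thesis
    using continuous_on_vec_lambda[of S "\<lambda>i x. (f x \<cdot>\<^sub>q g x) $ i"] by simp
qed

lemma continuous_on_qconj [continuous_intros]:
  assumes "continuous_on S f"
  shows "continuous_on S (\<lambda>x. qconj (f x))"
proof -
  have "continuous_on S (\<lambda>x. qconj (f x) $ i)" for i
    using exhaust_4[of i]
    by (elim disjE) (simp_all add: qconj_nth, (intro continuous_intros assms)+)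
  then show ?thesis
    using continuous_on_vec_lambda[of S "\<lambda>i x. qconj (f x) $ i"] by simp
qed

lemma openin_S3_preimage:
  assumes "continuous_on S3 f" and "\<And>x. x \<in> S3 \<Longrightarrow> f x \<in> S3" and "openin S3_top A"
  shows "openin S3_top {x \<in> S3. f x \<in> A}"
proof -
  have "{x \<in> S3. f x \<in> A} = S3 \<inter> f -` A"
    by blast
  then show ?thesis
    using assms continuous_openin_preimage[of S3 f S3 A] by (auto simp: S3_top_def)
qed

lemma in_closure_of_S3: "x \<in> S3_top closure_of A \<Longrightarrow> x \<in> S3"
  using closure_of_subset_topspace[of S3_top A] by (auto simp: S3_top_def)

lemma in_interior_of_S3: "x \<in> S3_top interior_of A \<Longrightarrow> x \<in> S3"
  using interior_of_subset_topspace[of S3_top A] by (auto simp: S3_top_def)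

text \<open>The product of the closures is the continuous image of a compact set, hence closed.\<close>

lemma closure_of_minkowski_prod_subset:
  assumes "U \<subseteq> S3" and "V \<subseteq> S3"
  shows "S3_top closure_of (U \<otimes>\<^sub>q V) \<subseteq> (S3_top closure_of U) \<otimes>\<^sub>q (S3_top closure_of V)"
proof -
  let ?P = "(S3_top closure_of U) \<otimes>\<^sub>q (S3_top closure_of V)"
  have cpt: "compact (S3_top closure_of A)" for A
  proof -
    have "compact S3"
      by (simp add: S3_def)
    moreover have "closedin (top_of_set S3) (S3_top closure_of A)"
      by (metis S3_top_def closedin_closure_of)
    ultimately show ?thesis
      by (rule closedin_compact)
  qed
  have "?P = (\<lambda>p. fst p \<cdot>\<^sub>q snd p) ` ((S3_top closure_of U) \<times> (S3_top closure_of V))"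
    by (force simp: minkowski_prod_def)
  moreover have "compact \<dots>"
    by (intro compact_continuous_image compact_Times cpt continuous_intros)
  ultimately have "closed ?P"
    by (simp add: compact_imp_closed)
  moreover have "?P \<subseteq> S3"
    using in_closure_of_S3 qmult_in_S3 by (auto simp: minkowski_prod_def)
  ultimately have "closedin S3_top ?P"
    by (simp add: S3_top_def closed_subset)
  moreover have "U \<otimes>\<^sub>q V \<subseteq> ?P"
    using closure_of_subset[of U S3_top] closure_of_subset[of V S3_top] assms
    by (auto simp: minkowski_prod_def S3_top_def)
  ultimately show ?thesis
    by (simp add: closure_of_minimal)
qed

text \<open>
  The quotient of \<open>u \<cdot>\<^sub>q v\<close> by \<open>w\<close> depends continuously on \<open>w\<close> and is \<open>u\<close> at \<open>w = v\<close>, so it stays in the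
  interior of \<open>U\<close> for some \<open>w \<in> V\<close>; right translation by \<open>w\<close> then carries this
  interior to a neighbourhood of \<open>u \<cdot>\<^sub>q v\<close>.
\<close>

lemma qmult_interior_closure:
  assumes u: "u \<in> S3_top interior_of U" and v: "v \<in> S3_top closure_of V"
  shows "u \<cdot>\<^sub>q v \<in> S3_top interior_of (U \<otimes>\<^sub>q V)"
proof -
  let ?I = "S3_top interior_of U"
  have uS: "u \<in> S3" and vS: "v \<in> S3"
    using u v in_interior_of_S3 in_closure_of_S3 by auto
  have "openin S3_top {w \<in> S3. (u \<cdot>\<^sub>q v) \<cdot>\<^sub>q qconj w \<in> ?I}"
    by (intro openin_S3_preimage continuous_intros qmult_in_S3 qconj_in_S3 uS vS
        openin_interior_of)
  moreover have "v \<in> {w \<in> S3. (u \<cdot>\<^sub>q v) \<cdot>\<^sub>q qconj w \<in> ?I}"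
    using u vS by (simp add: qmult_qconj_cancel)
  ultimately obtain w where w: "w \<in> V" "w \<in> S3" "(u \<cdot>\<^sub>q v) \<cdot>\<^sub>q qconj w \<in> ?I"
    using v unfolding in_closure_of by (metis (no_types, lifting) mem_Collect_eq)
  let ?N = "{x \<in> S3. x \<cdot>\<^sub>q qconj w \<in> ?I}"
  have "openin S3_top ?N"
    using w(2) by (intro openin_S3_preimage continuous_intros qmult_in_S3 qconj_in_S3
        openin_interior_of)
  moreover have "?N \<subseteq> U \<otimes>\<^sub>q V"
  proof
    fix x assume "x \<in> ?N"
    then have "x \<cdot>\<^sub>q qconj w \<in> U"
      using interior_of_subset[of S3_top U] by auto
    moreover have "x = (x \<cdot>\<^sub>q qconj w) \<cdot>\<^sub>q w"
      using w(2) by (simp add: qmult_qconj_cancel)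
    ultimately show "x \<in> U \<otimes>\<^sub>q V"
      using w(1) unfolding minkowski_prod_def by blast
  qed
  moreover have "u \<cdot>\<^sub>q v \<in> ?N"
    using uS vS w(3) by (simp add: qmult_in_S3)
  ultimately show ?thesis
    using interior_of_maximal[of ?N "U \<otimes>\<^sub>q V" S3_top] by blast
qed

text \<open>The mirror image, with left quotients \<open>qconj w \<cdot>\<^sub>q (u \<cdot>\<^sub>q v)\<close> and left translation.\<close>

lemma qmult_closure_interior:
  assumes u: "u \<in> S3_top closure_of U" and v: "v \<in> S3_top interior_of V"
  shows "u \<cdot>\<^sub>q v \<in> S3_top interior_of (U \<otimes>\<^sub>q V)"
proof -
  let ?I = "S3_top interior_of V"
  have uS: "u \<in> S3" and vS: "v \<in> S3"
    using u v in_interior_of_S3 in_closure_of_S3 by auto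
  have "openin S3_top {w \<in> S3. qconj w \<cdot>\<^sub>q (u \<cdot>\<^sub>q v) \<in> ?I}"
    by (intro openin_S3_preimage continuous_intros qmult_in_S3 qconj_in_S3 uS vS
        openin_interior_of)
  moreover have "u \<in> {w \<in> S3. qconj w \<cdot>\<^sub>q (u \<cdot>\<^sub>q v) \<in> ?I}"
    using v uS by (simp add: qmult_qconj_cancel)
  ultimately obtain w where w: "w \<in> U" "w \<in> S3" "qconj w \<cdot>\<^sub>q (u \<cdot>\<^sub>q v) \<in> ?I"
    using u unfolding in_closure_of by (metis (no_types, lifting) mem_Collect_eq)
  let ?N = "{x \<in> S3. qconj w \<cdot>\<^sub>q x \<in> ?I}"
  have "openin S3_top ?N"
    using w(2) by (intro openin_S3_preimage continuous_intros qmult_in_S3 qconj_in_S3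
        openin_interior_of)
  moreover have "?N \<subseteq> U \<otimes>\<^sub>q V"
  proof
    fix x assume "x \<in> ?N"
    then have "qconj w \<cdot>\<^sub>q x \<in> V"
      using interior_of_subset[of S3_top V] by auto
    moreover have "x = w \<cdot>\<^sub>q (qconj w \<cdot>\<^sub>q x)"
      using w(2) by (simp add: qmult_qconj_cancel)
    ultimately show "x \<in> U \<otimes>\<^sub>q V"
      using w(1) unfolding minkowski_prod_def by blast
  qed
  moreover have "u \<cdot>\<^sub>q v \<in> ?N"
    using uS vS w(3) by (simp add: qmult_in_S3)
  ultimately show ?thesis
    using interior_of_maximal[of ?N "U \<otimes>\<^sub>q V" S3_top] by blast
qed

theorem corollary2:
  fixes U V :: "quat set"
  assumes "U \<subseteq> S3" and "V \<subseteq> S3"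
  shows "S3_top frontier_of (U \<otimes>\<^sub>q V) \<subseteq> (S3_top frontier_of U) \<otimes>\<^sub>q (S3_top frontier_of V)"
proof
  fix z assume "z \<in> S3_top frontier_of (U \<otimes>\<^sub>q V)"
  then have cl: "z \<in> S3_top closure_of (U \<otimes>\<^sub>q V)"
    and not_int: "z \<notin> S3_top interior_of (U \<otimes>\<^sub>q V)"
    by (auto simp: frontier_of_def)
  obtain u v where uv: "u \<in> S3_top closure_of U" "v \<in> S3_top closure_of V" "z = u \<cdot>\<^sub>q v"
    using cl closure_of_minkowski_prod_subset[OF assms] unfolding minkowski_prod_def by blast
  have "u \<notin> S3_top interior_of U" "v \<notin> S3_top interior_of V"
    using not_int uv qmult_interior_closure qmult_closure_interior by blast+
  then have "u \<in> S3_top frontier_of U" "v \<in> S3_top frontier_of V"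
    using uv by (auto simp: frontier_of_def)
  then show "z \<in> (S3_top frontier_of U) \<otimes>\<^sub>q (S3_top frontier_of V)"
    using uv(3) unfolding minkowski_prod_def by blast
qed

end
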